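(* Let $\nabla^{Inv}$ be the covariant derivative (Levi-Civita connection) of the Riemannian manifold $(Gl(2n,\mathbb{R}),\langle\cdot,\cdot\rangle_{Inv})$. Then for $M\in Gl(2n,\mathbb{R})$: (a) for two vector fields $X,Y$ on $Gl(2n,\mathbb{R})$, $$(\nabla^{Inv}_{X}Y)_{M}=X_M(Y)-\frac{1}{2}\Big(Y_MM^{-1}X_M+X_MM^{-1}Y_M+MY_M^TM^{-T}M^{-1}X_M+MX_M^TM^{-T}M^{-1}Y_M-Y_MX_M^TM^{-T}-X_MY_M^TM^{-T}\Big);$$ (b) for two left invariant vector fields $X,Y$ on $Gl(2n,\mathbb{R})$, i.e. $X_M=MX_0$, $Y_M=MY_0$ with $X_0,Y_0\in\mathcal{M}_{2n}(\mathbb{R})$, $$(\nabla^{Inv}_{X}Y)_{M}=\frac{1}{2}M\left([X_0,Y_0]-[Y_0^T,X_0]-[X_0^T,Y_0]\right).$$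
   Context: $\mathcal{M}_{2n}(\mathbb{R})$ is the space of real $2n\times 2n$ matrices and $Gl(2n,\mathbb{R})$ its open subset of invertible matrices, so $T_MGl(2n,\mathbb{R})=\mathcal{M}_{2n}(\mathbb{R})$. The left invariant metric is $\langle X_M,Y_M\rangle_{Inv}=\mathrm{tr}\big((M^{-1}X_M)^TM^{-1}Y_M\big)=\mathrm{tr}(X_M^TM^{-T}M^{-1}Y_M)$ for $X_M,Y_M\in T_MGl(2n,\mathbb{R})$. Vector fields are smooth; $X_M$ is the value of $X$ at $M$; $X_M(Y)$ is the ordinary directional derivative at $M$, in the direction $X_M$, of $Y$ regarded as an $\mathcal{M}_{2n}(\mathbb{R})$-valued function. $[X,Y]=XY-YX$ is the matrix commutator, and $M^{-T}=(M^{-1})^T$. *)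

theory Defs
  imports "HOL-Analysis.Analysis"
begin

section \<open>Smooth functions on open sets\<close>

text \<open>
  \<open>C_k_on S k f\<close>: all iterated directional derivatives of \<open>f\<close> up to order \<open>k\<close> exist and are
  continuous on \<open>S\<close>.  Intended for open \<open>S\<close> in a finite-dimensional space.  The derivatives are
  taken in the ambient space, so for open \<open>S\<close> values outside \<open>S\<close> are irrelevant.
\<close>

primrec C_k_on :: "'a::real_normed_vector set \<Rightarrow> nat \<Rightarrow> ('a \<Rightarrow> 'b::real_normed_vector) \<Rightarrow> bool" where
  "C_k_on S 0 f \<longleftrightarrow> continuous_on S f"
| "C_k_on S (Suc k) f \<longleftrightarrow>
     (\<forall>x\<in>S. f differentiable (at x)) \<and>
     (\<forall>v. C_k_on S k (\<lambda>x. frechet_derivative f (at x) v))"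

definition smooth_on :: "'a::real_normed_vector set \<Rightarrow> ('a \<Rightarrow> 'b::real_normed_vector) \<Rightarrow> bool" where
  "smooth_on S f \<longleftrightarrow> (\<forall>k. C_k_on S k f)"


section \<open>Vector fields and the Levi-Civita connection on an open set\<close>

text \<open>
  The tangent space of an open subset \<open>S\<close> of a vector space \<open>'a\<close> is \<open>'a\<close> at every point; a vector
  field on \<open>S\<close> is a total function \<open>'a \<Rightarrow> 'a\<close> that is smooth on \<open>S\<close>.
\<close>

text \<open>\<open>dir_deriv X f p\<close> is \<open>X\<^sub>p(f)\<close>, for real-valued and for vector-valued \<open>f\<close>.\<close>

definition dir_deriv ::
    "('a::real_normed_vector \<Rightarrow> 'a) \<Rightarrow> ('a \<Rightarrow> 'b::real_normed_vector) \<Rightarrow> 'a \<Rightarrow> 'b" where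
  "dir_deriv X f p = frechet_derivative f (at p) (X p)"

definition lie_bracket :: "('a::real_normed_vector \<Rightarrow> 'a) \<Rightarrow> ('a \<Rightarrow> 'a) \<Rightarrow> 'a \<Rightarrow> 'a" where
  "lie_bracket X Y p = dir_deriv X Y p - dir_deriv Y X p"

text \<open>
  All laws are required only on \<open>S\<close> and only for fields that are smooth on \<open>S\<close>.  That
  \<open>nabla X Y\<close> on \<open>S\<close> depends only on the restrictions of \<open>X\<close> and \<open>Y\<close> to \<open>S\<close> need not be
  postulated: a field \<open>Z\<close> vanishing on \<open>S\<close> equals \<open>f Z\<close>, where \<open>f\<close> is \<open>0\<close> on \<open>S\<close> and \<open>1\<close>
  elsewhere, so the function-linearity and Leibniz laws give \<open>nabla Z Y = 0\<close> and
  \<open>nabla X Z = 0\<close> on (open) \<open>S\<close>.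
\<close>

locale affine_connection =
  fixes S :: "'a::real_normed_vector set"
    and nabla :: "('a \<Rightarrow> 'a) \<Rightarrow> ('a \<Rightarrow> 'a) \<Rightarrow> 'a \<Rightarrow> 'a"
  assumes smooth: "\<lbrakk>smooth_on S X; smooth_on S Y\<rbrakk> \<Longrightarrow> smooth_on S (nabla X Y)"
    and add_left: "\<lbrakk>smooth_on S X; smooth_on S X'; smooth_on S Y; p \<in> S\<rbrakk>
      \<Longrightarrow> nabla (\<lambda>q. X q + X' q) Y p = nabla X Y p + nabla X' Y p"
    and scale_left: "\<lbrakk>smooth_on S (f :: 'a \<Rightarrow> real); smooth_on S X; smooth_on S Y; p \<in> S\<rbrakk>
      \<Longrightarrow> nabla (\<lambda>q. f q *\<^sub>R X q) Y p = f p *\<^sub>R nabla X Y p"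
    and add_right: "\<lbrakk>smooth_on S X; smooth_on S Y; smooth_on S Y'; p \<in> S\<rbrakk>
      \<Longrightarrow> nabla X (\<lambda>q. Y q + Y' q) p = nabla X Y p + nabla X Y' p"
    and leibniz: "\<lbrakk>smooth_on S (f :: 'a \<Rightarrow> real); smooth_on S X; smooth_on S Y; p \<in> S\<rbrakk>
      \<Longrightarrow> nabla X (\<lambda>q. f q *\<^sub>R Y q) p = dir_deriv X f p *\<^sub>R Y p + f p *\<^sub>R nabla X Y p"

locale levi_civita_connection = affine_connection S nabla
  for S :: "'a::real_normed_vector set"
    and g :: "'a \<Rightarrow> 'a \<Rightarrow> 'a \<Rightarrow> real"
    and nabla :: "('a \<Rightarrow> 'a) \<Rightarrow> ('a \<Rightarrow> 'a) \<Rightarrow> 'a \<Rightarrow> 'a" +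
  assumes torsion_free: "\<lbrakk>smooth_on S X; smooth_on S Y; p \<in> S\<rbrakk>
      \<Longrightarrow> nabla X Y p - nabla Y X p = lie_bracket X Y p"
    and metric: "\<lbrakk>smooth_on S X; smooth_on S Y; smooth_on S Z; p \<in> S\<rbrakk>
      \<Longrightarrow> dir_deriv X (\<lambda>q. g q (Y q) (Z q)) p
          = g p (nabla X Y p) (Z p) + g p (Y p) (nabla X Z p)"


section \<open>The general linear group with its left invariant metric\<close>

definition GL :: "(real^'m^'m) set" where
  "GL = {M. invertible M}"

definition inv_metric :: "real^'m^'m \<Rightarrow> real^'m^'m \<Rightarrow> real^'m^'m \<Rightarrow> real" where
  "inv_metric M A B = trace (transpose (matrix_inv M ** A) ** (matrix_inv M ** B))"

definition commutator :: "real^'m^'m \<Rightarrow> real^'m^'m \<Rightarrow> real^'m^'m" where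
  "commutator A B = A ** B - B ** A"

end

theory Submission
  imports Defs
begin

text \<open>
  The Koszul formula determines \<open>\<langle>\<nabla>\<^sub>X Y, Z\<rangle>\<close> for every field \<open>Z\<close>, and constant \<open>Z\<close> suffice. Since
  \<open>\<langle>A, B\<rangle>\<^sub>M\<close> is the Frobenius product of \<open>M\<^sup>-\<^sup>1 A\<close> and \<open>M\<^sup>-\<^sup>1 B\<close>, and the derivative of \<open>M\<^sup>-\<^sup>1\<close> in the
  direction \<open>H\<close> is \<open>- M\<^sup>-\<^sup>1 H M\<^sup>-\<^sup>1\<close>, each derivative of the metric is a sum of Frobenius products, and
  \<open>Z\<close> is isolated by moving factors across the product as transposes. Differentiability of the
  inverse comes from Cramer's rule.
\<close>

section \<open>Matrix calculus\<close>

text \<open>Both sides are the triple sum of \<open>A$i$k * B$k$j * C$i$j\<close>; the proof only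
  changes the order of summation. This adjunction is what frees the test matrix in the Koszul
  formula.\<close>

lemma inner_matrix_mult_left:
  fixes A B C :: "real^'m^'m"
  shows "inner (A ** B) C = inner B (transpose A ** C)"
proof -
  have "inner (A ** B) C = (\<Sum>i\<in>UNIV. \<Sum>j\<in>UNIV. \<Sum>k\<in>UNIV. A$i$k * B$k$j * C$i$j)"
    by (simp add: inner_vec_def matrix_matrix_mult_def sum_distrib_right)
  also have "\<dots> = (\<Sum>i\<in>UNIV. \<Sum>k\<in>UNIV. \<Sum>j\<in>UNIV. A$i$k * B$k$j * C$i$j)"
    by (intro sum.cong refl sum.swap)
  also have "\<dots> = (\<Sum>k\<in>UNIV. \<Sum>i\<in>UNIV. \<Sum>j\<in>UNIV. A$i$k * B$k$j * C$i$j)"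
    by (rule sum.swap)
  also have "\<dots> = (\<Sum>k\<in>UNIV. \<Sum>j\<in>UNIV. \<Sum>i\<in>UNIV. A$i$k * B$k$j * C$i$j)"
    by (intro sum.cong refl sum.swap)
  also have "\<dots> = inner B (transpose A ** C)"
    by (simp add: inner_vec_def matrix_matrix_mult_def transpose_def sum_distrib_left mult_ac)
  finally show ?thesis .
qed

lemma inner_transpose:
  fixes A B :: "real^'m^'m"
  shows "inner (transpose A) (transpose B) = inner A B"
  unfolding inner_vec_def transpose_def by simp (rule sum.swap)

text \<open>Transposing both arguments preserves the Frobenius product and turns right factors into
  left ones.\<close>

lemma inner_matrix_mult_right:
  fixes A B C :: "real^'m^'m"
  shows "inner (A ** B) C = inner A (C ** transpose B)"
  using inner_matrix_mult_left[of "transpose B" "transpose A" "transpose C"]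
    inner_transpose[of "A ** B" C] inner_transpose[of A "C ** transpose B"]
  by (simp add: matrix_transpose_mul)

lemma trace_transpose_mult_eq_inner:
  fixes A B :: "real^'m^'m"
  shows "trace (transpose A ** B) = inner A B"
  unfolding trace_def inner_vec_def matrix_matrix_mult_def transpose_def
  by simp (rule sum.swap)

lemma inv_metric_eq_inner: "inv_metric M A B = inner (matrix_inv M ** A) (matrix_inv M ** B)"
  by (simp add: inv_metric_def trace_transpose_mult_eq_inner)

lemma bounded_bilinear_matrix_mult:
  "bounded_bilinear ((**) :: real^'m^'m \<Rightarrow> real^'m^'m \<Rightarrow> real^'m^'m)"
  unfolding bilinear_conv_bounded_bilinear[symmetric] bilinear_def
  by (intro conjI allI linearI)
    (simp_all add: vec_eq_iff matrix_matrix_mult_def sum.distrib sum_distrib_left algebra_simps)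

interpretation matrix_mult:
  bounded_bilinear "(**) :: real^'m^'m \<Rightarrow> real^'m^'m \<Rightarrow> real^'m^'m"
  by (rule bounded_bilinear_matrix_mult)

lemma GL_iff_det: "M \<in> GL \<longleftrightarrow> det M \<noteq> 0"
  by (simp add: GL_def invertible_det_nz)

lemma matrix_inv_right_GL: "M \<in> GL \<Longrightarrow> M ** matrix_inv M = mat 1"
  and matrix_inv_left_GL: "M \<in> GL \<Longrightarrow> matrix_inv M ** M = mat 1"
  unfolding GL_def matrix_inv_def invertible_def mem_Collect_eq by (drule someI_ex, simp)+

lemma differentiable_prod:
  fixes f :: "'i \<Rightarrow> 'a::real_normed_vector \<Rightarrow> real"
  assumes "\<And>i. i \<in> I \<Longrightarrow> f i differentiable (at x)"
  shows "(\<lambda>x. \<Prod>i\<in>I. f i x) differentiable (at x)"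
  using assms by (induct I rule: infinite_finite_induct) auto

lemma differentiable_det:
  fixes f :: "'a::real_normed_vector \<Rightarrow> real^'m^'m"
  assumes "\<And>i j. (\<lambda>x. f x $ i $ j) differentiable (at x)"
  shows "(\<lambda>x. det (f x)) differentiable (at x)"
  unfolding det_def
  by (intro differentiable_sum ballI differentiable_mult differentiable_prod assms
      differentiable_const finite_permutations finite)

lemma differentiable_vec:
  fixes f :: "'a::real_normed_vector \<Rightarrow> ('b::euclidean_space)^'m"
  assumes "\<And>i. (\<lambda>x. f x $ i) differentiable (at x)"
  shows "f differentiable (at x)"
  unfolding differentiable_componentwise_within[of f]
  using assms by (auto simp: Basis_vec_def inner_axis intro!: differentiable_inner)

lemma differentiable_entry:
  "(\<lambda>q::real^'m^'m. q $ i $ j) differentiable (at x)"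
  by (intro linear_imp_differentiable linearI) simp_all

lemma open_GL: "open (GL :: (real^'m^'m) set)"
proof -
  have "continuous_on UNIV (det :: real^'m^'m \<Rightarrow> real)"
    using differentiable_det[of "\<lambda>q. q", OF differentiable_entry]
    by (intro continuous_at_imp_continuous_on ballI differentiable_imp_continuous_within) simp
  then have "open (det -` (- {0}) :: (real^'m^'m) set)"
    by (intro open_vimage) auto
  moreover have "det -` (- {0}) = (GL :: (real^'m^'m) set)"
    by (auto simp: GL_iff_det)
  ultimately show ?thesis by simp
qed

text \<open>Column \<open>j\<close> of the inverse solves \<open>q *v x = axis j 1\<close>, so
  Cramer's rule gives its entries.\<close>

lemma matrix_inv_cramer:
  fixes q :: "real^'m^'m"
  assumes "q \<in> GL"
  shows "matrix_inv q $ k $ j = det (\<chi> i l. if l = k then axis j 1 $ i else q $ i $ l) / det q"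
proof -
  have "q *v (matrix_inv q *v axis j 1) = axis j 1"
    by (simp add: matrix_vector_mul_assoc matrix_inv_right_GL assms)
  with assms have "matrix_inv q *v axis j 1
      = (\<chi> k. det (\<chi> i l. if l = k then axis j 1 $ i else q $ i $ l) / det q)"
    by (subst (asm) cramer) (auto simp: GL_iff_det)
  then show ?thesis
    by (simp add: matrix_vector_mult_basis column_def vec_eq_iff)
qed

lemma differentiable_matrix_inv:
  fixes M :: "real^'m^'m"
  assumes M: "M \<in> GL"
  shows "matrix_inv differentiable (at M)"
proof (intro differentiable_vec)
  fix k j
  let ?c = "\<lambda>q :: real^'m^'m. det (\<chi> i l. if l = k then axis j 1 $ i else q $ i $ l) / det q"
  \<comment> \<open>Each entry is a constant in the replaced column and a coordinate of
    \<open>q\<close> elsewhere.\<close>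
  have "(\<lambda>q. (\<chi> i l. if l = k then axis j 1 $ i else q $ i $ l) $ i' $ l') differentiable (at M)" for i' l'
    by (cases "l' = k") (simp_all add: differentiable_entry)
  then have "?c differentiable (at M)"
    using M by (intro differentiable_divide differentiable_det differentiable_entry)
      (simp_all add: GL_iff_det)
  then obtain D where "(?c has_derivative D) (at M)"
    by (auto simp: differentiable_def)
  \<comment> \<open>Cramer's quotient is known to equal the inverse only on \<open>GL\<close>;
    openness suffices to transfer the derivative.\<close>
  then have "((\<lambda>q. matrix_inv q $ k $ j) has_derivative D) (at M)"
    by (rule has_derivative_transform_within_open[OF _ open_GL M]) (simp add: matrix_inv_cramer)
  then show "(\<lambda>q. matrix_inv q $ k $ j) differentiable (at M)"
    by (auto simp: differentiable_def)
qed

text \<open>Once a derivative \<open>D\<close> exists, differentiating the locally constant product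
  \<open>matrix_inv q ** q\<close> gives a linear equation for \<open>D H\<close>, solved by
  multiplying with the inverse on the right.\<close>

lemma has_derivative_matrix_inv:
  fixes M :: "real^'m^'m"
  assumes M: "M \<in> GL"
  shows "(matrix_inv has_derivative (\<lambda>H. - (matrix_inv M ** H ** matrix_inv M))) (at M)"
proof -
  obtain D where D: "(matrix_inv has_derivative D) (at M)"
    using differentiable_matrix_inv[OF M] by (auto simp: differentiable_def)
  have "((\<lambda>q. matrix_inv q ** q) has_derivative (\<lambda>H. matrix_inv M ** H + D H ** M)) (at M)"
    by (rule matrix_mult.FDERIV[OF D has_derivative_ident])
  moreover have "((\<lambda>q. matrix_inv q ** q) has_derivative (\<lambda>H. 0)) (at M)"
    by (rule has_derivative_transform_within_open[OF has_derivative_const[of "mat 1"] open_GL M])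
      (simp add: matrix_inv_left_GL)
  ultimately have "(\<lambda>H. matrix_inv M ** H + D H ** M) = (\<lambda>H. 0)"
    by (rule has_derivative_unique)
  then have eq: "matrix_inv M ** H + D H ** M = 0" for H
    by (rule fun_cong)
  have "D H = - (matrix_inv M ** H ** matrix_inv M)" for H
  proof -
    have "D H ** M = - (matrix_inv M ** H)"
      using eq[of H] by (simp add: add_eq_0_iff)
    then have "D H ** M ** matrix_inv M = - (matrix_inv M ** H ** matrix_inv M)"
      by (simp add: matrix_mult.minus_left)
    then show ?thesis
      by (simp add: matrix_mul_assoc[symmetric] matrix_inv_right_GL M)
  qed
  then have "D = (\<lambda>H. - (matrix_inv M ** H ** matrix_inv M))"
    by (rule ext)
  with D show ?thesis by simp
qed


section \<open>Smooth fields\<close>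

lemma smooth_on_imp_differentiable: "smooth_on S f \<Longrightarrow> x \<in> S \<Longrightarrow> f differentiable (at x)"
  using C_k_on.simps(2)[of S 0 f] unfolding smooth_on_def by blast

lemma C_k_on_const: "C_k_on S k (\<lambda>x. c)"
  by (induction k arbitrary: c) simp_all

lemma smooth_on_const: "smooth_on S (\<lambda>x. c)"
  by (simp add: smooth_on_def C_k_on_const)

text \<open>Near a point of an open set the two functions coincide, so their derivatives do too. The
  induction must vary \<open>f\<close> and \<open>g\<close>, since it passes to their directional
  derivatives.\<close>

lemma C_k_on_cong:
  assumes "open S" "\<And>x. x \<in> S \<Longrightarrow> f x = g x" "C_k_on S k f"
  shows "C_k_on S k g"
  using assms(2,3)
proof (induction k arbitrary: f g)
  case 0
  then show ?case by (simp cong: continuous_on_cong)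
next
  case (Suc k)
  have D: "(g has_derivative frechet_derivative f (at x)) (at x)" if "x \<in> S" for x
  proof (rule has_derivative_transform_within_open[OF _ \<open>open S\<close> that])
    show "(f has_derivative frechet_derivative f (at x)) (at x)"
      using Suc.prems(2) that by (simp flip: frechet_derivative_works)
  qed (rule Suc.prems(1))
  then have "frechet_derivative f (at x) = frechet_derivative g (at x)" if "x \<in> S" for x
    using that frechet_derivative_at by blast
  then have "C_k_on S k (\<lambda>x. frechet_derivative g (at x) v)" for v
    using Suc.IH[of "\<lambda>x. frechet_derivative f (at x) v"] Suc.prems by simp
  with D show ?case by (auto simp: differentiable_def)
qed

text \<open>The derivative is the map itself at every point, so each directional derivative is
  constant.\<close>

lemma smooth_on_bounded_linear:
  assumes "open S" "bounded_linear f"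
  shows "smooth_on S f"
  unfolding smooth_on_def
proof
  fix k
  have D: "(f has_derivative f) (at x)" for x
    by (rule bounded_linear.has_derivative[OF assms(2) has_derivative_ident])
  show "C_k_on S k f"
  proof (cases k)
    case 0
    then show ?thesis
      using linear_continuous_on[OF assms(2)] by simp
  next
    case (Suc l)
    have "frechet_derivative f (at x) = f" for x
      using D frechet_derivative_at by metis
    with Suc D show ?thesis by (auto simp: differentiable_def C_k_on_const)
  qed
qed


section \<open>The Koszul formula\<close>

text \<open>The product rule is applied to \<open>matrix_inv q ** Y q\<close> and
  \<open>matrix_inv q ** Z q\<close>; the subtracted terms come from differentiating the
  inverse.\<close>

lemma dir_deriv_inv_metric:
  assumes M: "M \<in> GL" and Y: "Y differentiable (at M)" and Z: "Z differentiable (at M)"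
  defines "N \<equiv> matrix_inv M"
  shows "dir_deriv X (\<lambda>q. inv_metric q (Y q) (Z q)) M =
    inner (N ** dir_deriv X Y M - N ** X M ** N ** Y M) (N ** Z M)
    + inner (N ** Y M) (N ** dir_deriv X Z M - N ** X M ** N ** Z M)"
proof -
  have DY: "(Y has_derivative frechet_derivative Y (at M)) (at M)"
    and DZ: "(Z has_derivative frechet_derivative Z (at M)) (at M)"
    using Y Z by (simp_all add: frechet_derivative_works)
  note D = has_derivative_inner[OF
      matrix_mult.FDERIV[OF has_derivative_matrix_inv[OF M] DY]
      matrix_mult.FDERIV[OF has_derivative_matrix_inv[OF M] DZ]]
  show ?thesis
    unfolding dir_deriv_def inv_metric_eq_inner N_def
    by (subst frechet_derivative_at[OF D, symmetric])
      (simp add: matrix_mult.minus_left)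
qed

lemma inv_metric_commute: "inv_metric q A B = inv_metric q B A"
  by (simp add: inv_metric_eq_inner inner_commute)

lemma inv_metric_diff_left: "inv_metric q (A - A') B = inv_metric q A B - inv_metric q A' B"
  by (simp add: inv_metric_eq_inner matrix_mult.diff_right inner_diff_left)

context levi_civita_connection
begin

text \<open>Metric compatibility expands the three derivatives and torsion-freeness turns the
  brackets into differences of covariant derivatives. By symmetry of \<open>g\<close> everything
  cancels except two copies of the \<open>nabla X Y\<close> term.\<close>

lemma koszul:
  assumes sym: "\<And>q A B. g q A B = g q B A"
    and diff: "\<And>q A A' B. g q (A - A') B = g q A B - g q A' B"
    and X: "smooth_on S X" and Y: "smooth_on S Y" and Z: "smooth_on S Z" and p: "p \<in> S"
  shows "2 * g p (nabla X Y p) (Z p) =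
    dir_deriv X (\<lambda>q. g q (Y q) (Z q)) p + dir_deriv Y (\<lambda>q. g q (X q) (Z q)) p
    - dir_deriv Z (\<lambda>q. g q (X q) (Y q)) p
    + g p (lie_bracket X Y p) (Z p) - g p (lie_bracket X Z p) (Y p) - g p (lie_bracket Y Z p) (X p)"
  using metric[OF X Y Z p] metric[OF Y X Z p] metric[OF Z X Y p]
    sym[of p "Y p" "nabla X Z p"] sym[of p "X p" "nabla Y Z p"] sym[of p "X p" "nabla Z Y p"]
  by (simp flip: torsion_free[OF X Y p] torsion_free[OF X Z p] torsion_free[OF Y Z p] add: diff)

end

section \<open>The connection for arbitrary fields\<close>

lemma levi_civita_GL:
  fixes M :: "real^'m^'m"
  assumes LC: "levi_civita_connection GL inv_metric nabla"
    and M: "M \<in> GL" and X: "smooth_on GL X" and Y: "smooth_on GL Y"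
  shows "nabla X Y M = dir_deriv X Y M - (1/2) *\<^sub>R
             (Y M ** matrix_inv M ** X M
            + X M ** matrix_inv M ** Y M
            + M ** transpose (Y M) ** transpose (matrix_inv M) ** matrix_inv M ** X M
            + M ** transpose (X M) ** transpose (matrix_inv M) ** matrix_inv M ** Y M
            - Y M ** transpose (X M) ** transpose (matrix_inv M)
            - X M ** transpose (Y M) ** transpose (matrix_inv M))"
proof -
  interpret levi_civita_connection GL inv_metric nabla by (fact LC)
  define N where "N = matrix_inv M"
  \<comment> \<open>Multiplying by \<open>N\<close> moves tangent vectors to the identity, where the
    metric is the Frobenius product.\<close>
  define a b n d where "a = N ** X M" and "b = N ** Y M" and "n = N ** nabla X Y M"
    and "d = N ** dir_deriv X Y M"
  \<comment> \<open>This is \<open>N\<close> times the bracketed expression of the claim.\<close>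
  define r where "r = a ** b + b ** a + transpose a ** b + transpose b ** a
    - b ** transpose a - a ** transpose b"
  have MN: "M ** N = mat 1" "N ** M = mat 1"
    by (simp_all add: N_def M matrix_inv_right_GL matrix_inv_left_GL)
  have "inner (2 *\<^sub>R n) c = inner (2 *\<^sub>R d - r) c" for c
  proof -
    \<comment> \<open>The constant field is chosen so that \<open>N ** Z M = c\<close> is an
      arbitrary test matrix and all derivatives of \<open>Z\<close> vanish.\<close>
    define Z :: "real^'m^'m \<Rightarrow> real^'m^'m" where "Z = (\<lambda>q. M ** c)"
    have Z: "smooth_on GL Z" "N ** Z M = c" "dir_deriv V Z M = 0" for V
      by (simp_all add: Z_def smooth_on_const matrix_mul_assoc MN dir_deriv_def)
    note diffs = X[THEN smooth_on_imp_differentiable, OF M]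
      Y[THEN smooth_on_imp_differentiable, OF M] Z(1)[THEN smooth_on_imp_differentiable, OF M]
    \<comment> \<open>The derivatives of \<open>X\<close> and \<open>Y\<close> along
      \<open>Z\<close> cancel against the brackets with \<open>Z\<close>, and those of
      \<open>X\<close> along \<open>Y\<close> against \<open>lie_bracket X Y\<close>. Besides
      \<open>d\<close>, only the six terms from differentiating the inverse survive.\<close>
    have "2 * inner n c = 2 * inner d c - inner (a ** b) c - inner b (a ** c)
        - inner (b ** a) c - inner a (b ** c) + inner (c ** a) b + inner a (c ** b)"
      using koszul[OF inv_metric_commute inv_metric_diff_left X Y Z(1) M]
      unfolding dir_deriv_inv_metric[OF M diffs(2,3)] dir_deriv_inv_metric[OF M diffs(1,3)]
        dir_deriv_inv_metric[OF M diffs(1,2)]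
      unfolding lie_bracket_def inv_metric_eq_inner N_def[symmetric]
      by (simp add: Z matrix_mult.diff_right inner_diff_left inner_diff_right
          matrix_mult.zero_right matrix_mult.minus_right inner_commute
          flip: a_def b_def n_def d_def matrix_mul_assoc)
    moreover have "inner b (a ** c) = inner (transpose a ** b) c"
      "inner a (b ** c) = inner (transpose b ** a) c"
      using inner_matrix_mult_left[of a c b] inner_matrix_mult_left[of b c a]
      by (simp_all add: inner_commute)
    \<comment> \<open>In the terms from differentiating along \<open>Z\<close>, \<open>c\<close> is
      the left factor, so here the right factor crosses the product.\<close>
    moreover have "inner (c ** a) b = inner (b ** transpose a) c"
      "inner a (c ** b) = inner (a ** transpose b) c"
      using inner_matrix_mult_right[of c a b] inner_matrix_mult_right[of c b a]
      by (simp_all add: inner_commute)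
    ultimately show ?thesis
      by (simp add: r_def inner_diff_left inner_add_left)
  qed
  then have "2 *\<^sub>R n = 2 *\<^sub>R d - r"
    by (metis vector_eq_rdot)
  then have "(1/2) *\<^sub>R (2 *\<^sub>R n) = (1/2) *\<^sub>R (2 *\<^sub>R d - r)" by simp
  then have "n = d - (1/2) *\<^sub>R r"
    by (simp add: scaleR_diff_right)
  then have "M ** n = M ** d - (1/2) *\<^sub>R (M ** r)"
    by (simp add: matrix_mult.diff_right matrix_mult.scaleR_right)
  then show ?thesis
    unfolding n_def d_def r_def a_def b_def N_def[symmetric]
    by (simp add: matrix_mult.diff_right matrix_mult.add_right matrix_mul_assoc MN
        matrix_transpose_mul)
qed

section \<open>Left invariant fields\<close>

lemma smooth_on_left_invariant:
  fixes X :: "real^'m^'m \<Rightarrow> real^'m^'m"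
  assumes "\<And>P. P \<in> GL \<Longrightarrow> X P = P ** A"
  shows "smooth_on GL X"
  \<comment> \<open>The field is prescribed only on \<open>GL\<close>, where it agrees with a linear
    map; congruence on the open set transfers smoothness.\<close>
  using smooth_on_bounded_linear[OF open_GL matrix_mult.bounded_linear_left[of A]] assms
  unfolding smooth_on_def by (metis C_k_on_cong[OF open_GL])

lemma dir_deriv_left_invariant:
  fixes Y :: "real^'m^'m \<Rightarrow> real^'m^'m"
  assumes "\<And>P. P \<in> GL \<Longrightarrow> Y P = P ** B" and M: "M \<in> GL"
  shows "dir_deriv X Y M = X M ** B"
proof -
  have "((\<lambda>P. P ** B) has_derivative (\<lambda>P. P ** B)) (at M)"
    by (rule bounded_linear_imp_has_derivative[OF matrix_mult.bounded_linear_left])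
  then have "(Y has_derivative (\<lambda>P. P ** B)) (at M)"
    by (rule has_derivative_transform_within_open[OF _ open_GL M]) (simp add: assms)
  then show ?thesis
    by (simp add: dir_deriv_def flip: frechet_derivative_at)
qed

theorem theorem3p4:
  fixes n :: nat
    and nabla :: "(real^'m^'m \<Rightarrow> real^'m^'m) \<Rightarrow> (real^'m^'m \<Rightarrow> real^'m^'m) \<Rightarrow> real^'m^'m \<Rightarrow> real^'m^'m"
    and M :: "real^'m^'m"
  assumes dim: "CARD('m::finite) = 2 * n"
    and LC: "levi_civita_connection GL inv_metric nabla"
    and M: "M \<in> GL"
  shows "(\<forall>X Y. smooth_on GL X \<longrightarrow> smooth_on GL Y \<longrightarrow>
           nabla X Y M = dir_deriv X Y M - (1/2) *\<^sub>R
             (Y M ** matrix_inv M ** X M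
            + X M ** matrix_inv M ** Y M
            + M ** transpose (Y M) ** transpose (matrix_inv M) ** matrix_inv M ** X M
            + M ** transpose (X M) ** transpose (matrix_inv M) ** matrix_inv M ** Y M
            - Y M ** transpose (X M) ** transpose (matrix_inv M)
            - X M ** transpose (Y M) ** transpose (matrix_inv M)))
       \<and> (\<forall>X Y X0 Y0. (\<forall>P\<in>GL. X P = P ** X0) \<longrightarrow> (\<forall>P\<in>GL. Y P = P ** Y0) \<longrightarrow>
           nabla X Y M = (1/2) *\<^sub>R
             (M ** (commutator X0 Y0 - commutator (transpose Y0) X0 - commutator (transpose X0) Y0)))"
proof (intro conjI allI impI)
  fix X Y :: "real^'m^'m \<Rightarrow> real^'m^'m"
  assume "smooth_on GL X" "smooth_on GL Y"
  then show "nabla X Y M = dir_deriv X Y M - (1/2) *\<^sub>R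
             (Y M ** matrix_inv M ** X M
            + X M ** matrix_inv M ** Y M
            + M ** transpose (Y M) ** transpose (matrix_inv M) ** matrix_inv M ** X M
            + M ** transpose (X M) ** transpose (matrix_inv M) ** matrix_inv M ** Y M
            - Y M ** transpose (X M) ** transpose (matrix_inv M)
            - X M ** transpose (Y M) ** transpose (matrix_inv M))"
    by (rule levi_civita_GL[OF LC M])
next
  fix X Y :: "real^'m^'m \<Rightarrow> real^'m^'m" and X0 Y0
  assume "\<forall>P\<in>GL. X P = P ** X0" "\<forall>P\<in>GL. Y P = P ** Y0"
  then have X: "\<And>P. P \<in> GL \<Longrightarrow> X P = P ** X0" and Y: "\<And>P. P \<in> GL \<Longrightarrow> Y P = P ** Y0"
    by auto
  \<comment> \<open>The second identity is the transpose of
    \<open>matrix_inv M ** M = mat 1\<close>.\<close>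
  have cancel: "A ** matrix_inv M ** M = A" "A ** transpose M ** transpose (matrix_inv M) = A" for A
    using M by (simp_all add: matrix_inv_left_GL flip: matrix_mul_assoc matrix_transpose_mul)
  have "nabla X Y M = M ** X0 ** Y0 - (1/2) *\<^sub>R
      (M ** Y0 ** X0 + M ** X0 ** Y0 + M ** transpose Y0 ** X0 + M ** transpose X0 ** Y0
       - M ** Y0 ** transpose X0 - M ** X0 ** transpose Y0)"
    by (subst levi_civita_GL[OF LC M smooth_on_left_invariant[OF X] smooth_on_left_invariant[OF Y]])
      (simp_all add: dir_deriv_left_invariant[OF Y M] X Y M matrix_transpose_mul
        matrix_mul_assoc cancel)
  \<comment> \<open>Half of \<open>M ** X0 ** Y0\<close> remains and pairs with
    \<open>M ** Y0 ** X0\<close> to the first commutator; the four terms with transposes pair to the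
    other two.\<close>
  also have "\<dots> = (1/2) *\<^sub>R
      (M ** (commutator X0 Y0 - commutator (transpose Y0) X0 - commutator (transpose X0) Y0))"
    by (simp add: commutator_def matrix_mult.diff_right matrix_mult.add_right
        matrix_mul_assoc vec_eq_iff field_simps)
  finally show "nabla X Y M = (1/2) *\<^sub>R
      (M ** (commutator X0 Y0 - commutator (transpose Y0) X0 - commutator (transpose X0) Y0))" .
qed

end
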